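(* Let $(\mathcal W\times\mathcal T,\mathbf K(W|T))$ be a transition probability space, let $F:\mathcal T\to\mathcal F$ and $H:\mathcal T\to\mathcal H$ be measurable maps with $\mathcal F$ a standard measurable space, considered as deterministic transitional random variables $(w,t)\mapsto F(t)$ and $(w,t)\mapsto H(t)$ on $(\mathcal W\times\mathcal T,\mathbf K(W|T))$, and let $\mathbf Y:\mathcal W\times\mathcal T\dashrightarrow\mathcal Y$ be another transitional random variable. Then the following are equivalent: 1. $F\perp\!\!\!\perp_{\mathbf K(W|T)}\mathbf Y\mid H$. 2. There exists a measurable function $\varphi:\mathcal H\to\mathcal F$ such that $F=\varphi\circ H$.
   Context: A Markov kernel $\mathbf K(W|T):\mathcal T\dashrightarrow\mathcal W$ between measurable spaces is a map $(D,t)\mapsto\mathbf K(W\in D|T=t)\in[0,1]$ that is a probability measure in the measurable set $D\subseteq\mathcal W$ for each $t$ and measurable in $t$ for each $D$. A transition probability space is a pair $(\mathcal W\times\mathcal T,\mathbf K(W|T))$ with $\mathbf K(W|T):\mathcal T\dashrightarrow\mathcal W$ a Markov kernel. A transitional random variable is a Markov kernel $\mathbf X:\mathcal W\times\mathcal T\dashrightarrow\mathcal X$ to a measurable space; a measurable map $X:\mathcal W\times\mathcal T\to\mathcal X$ is identified with the Dirac kernel $(w,t)\mapsto\boldsymbol\delta_{X(w,t)}$. The joint kernel of $\mathbf X,\mathbf Y,\mathbf Z$ is $\mathbf K(X,Y,Z|T=t)(E)=\int(\mathbf X(\cdot|w,t)\otimes\mathbf Y(\cdot|w,t)\otimes\mathbf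 Z(\cdot|w,t))(E)\,\mathbf K(W\in dw|T=t)$, and $\mathbf K(Y,Z|T)$ is its marginal. Transitional conditional independence: $\mathbf X\perp\!\!\!\perp_{\mathbf K(W|T)}\mathbf Y\mid\mathbf Z$ means that there exists a Markov kernel $\mathbf Q(X|Z):\mathcal Z\dashrightarrow\mathcal X$ with $\mathbf K(X,Y,Z|T)=\mathbf Q(X|Z)\otimes\mathbf K(Y,Z|T)$, i.e. for all $t$ and measurable $A,B,C$: $\mathbf K(X\in A,Y\in B,Z\in C|T=t)=\int\mathbf 1_B(y)\mathbf 1_C(z)\,\mathbf Q(X\in A|Z=z)\,\mathbf K((Y,Z)\in d(y,z)|T=t)$. A measurable space is standard if it is measurably isomorphic to a Borel subset of $[0,1]$. *)

theory Defs
  imports "HOL-Probability.Probability"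
begin

text \<open>
  A measurable space is represented by a \<open>'a measure\<close> of which only \<open>space\<close> and \<open>sets\<close> are used.
  The arrow \<open>T \<rightarrow>\<^sub>M prob_algebra W\<close> is the library's rendering of Markov kernels; lemma
  \<open>markov_kernel_iff\<close> below recovers the elementary definition.
\<close>

definition markov_kernel :: "'t measure \<Rightarrow> 'w measure \<Rightarrow> ('t \<Rightarrow> 'w measure) \<Rightarrow> bool" where
  "markov_kernel T W K \<longleftrightarrow> K \<in> T \<rightarrow>\<^sub>M prob_algebra W"

lemma markov_kernel_iff:
  "markov_kernel T W K \<longleftrightarrow>
     (\<forall>t\<in>space T. sets (K t) = sets W \<and> prob_space (K t)) \<and>
     (\<forall>D\<in>sets W. (\<lambda>t. emeasure (K t) D) \<in> borel_measurable T)"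
proof
  assume "markov_kernel T W K"
  then have K: "K \<in> T \<rightarrow>\<^sub>M prob_algebra W"
    by (simp add: markov_kernel_def)
  then have K': "K \<in> T \<rightarrow>\<^sub>M subprob_algebra W"
    by (rule measurable_prob_algebraD)
  show "(\<forall>t\<in>space T. sets (K t) = sets W \<and> prob_space (K t)) \<and>
     (\<forall>D\<in>sets W. (\<lambda>t. emeasure (K t) D) \<in> borel_measurable T)"
    using measurable_space[OF K] measurable_emeasure_kernel[OF K']
    by (auto simp: space_prob_algebra)
next
  assume *: "(\<forall>t\<in>space T. sets (K t) = sets W \<and> prob_space (K t)) \<and>
     (\<forall>D\<in>sets W. (\<lambda>t. emeasure (K t) D) \<in> borel_measurable T)"
  then have "K \<in> T \<rightarrow>\<^sub>M subprob_algebra W"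
    by (intro measurable_subprob_algebra) (auto intro: prob_space_imp_subprob_space)
  then show "markov_kernel T W K"
    unfolding markov_kernel_def using * by (intro measurable_prob_algebraI) auto
qed

definition transition_prob_space :: "'w measure \<Rightarrow> 't measure \<Rightarrow> ('t \<Rightarrow> 'w measure) \<Rightarrow> bool" where
  "transition_prob_space W T K \<longleftrightarrow> markov_kernel T W K"

definition transitional_rv ::
  "'w measure \<Rightarrow> 't measure \<Rightarrow> 'x measure \<Rightarrow> ('w \<times> 't \<Rightarrow> 'x measure) \<Rightarrow> bool" where
  "transitional_rv W T MX X \<longleftrightarrow> markov_kernel (W \<Otimes>\<^sub>M T) MX X"

definition dirac_kernel :: "'x measure \<Rightarrow> ('w \<times> 't \<Rightarrow> 'x) \<Rightarrow> 'w \<times> 't \<Rightarrow> 'x measure" where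
  "dirac_kernel MX X = (\<lambda>p. return MX (X p))"

text \<open>
  The joint kernel, as a mixture in the Giry monad; the integral formula is lemma
  \<open>emeasure_joint_kernel\<close>.
\<close>

definition joint_kernel ::
  "('t \<Rightarrow> 'w measure) \<Rightarrow> ('w \<times> 't \<Rightarrow> 'x measure) \<Rightarrow> ('w \<times> 't \<Rightarrow> 'y measure) \<Rightarrow>
   ('w \<times> 't \<Rightarrow> 'z measure) \<Rightarrow> 't \<Rightarrow> ('x \<times> 'y \<times> 'z) measure" where
  "joint_kernel K X Y Z t = K t \<bind> (\<lambda>w. X (w, t) \<Otimes>\<^sub>M (Y (w, t) \<Otimes>\<^sub>M Z (w, t)))"

lemma
  assumes K: "transition_prob_space W T K"
    and X: "transitional_rv W T MX X" and Y: "transitional_rv W T MY Y" and Z: "transitional_rv W T MZ Z"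
  shows markov_kernel_joint_kernel:
      "markov_kernel T (MX \<Otimes>\<^sub>M (MY \<Otimes>\<^sub>M MZ)) (joint_kernel K X Y Z)"
    and emeasure_joint_kernel:
      "\<lbrakk>t \<in> space T; E \<in> sets (MX \<Otimes>\<^sub>M (MY \<Otimes>\<^sub>M MZ))\<rbrakk> \<Longrightarrow>
       emeasure (joint_kernel K X Y Z t) E =
         (\<integral>\<^sup>+w. emeasure (X (w, t) \<Otimes>\<^sub>M (Y (w, t) \<Otimes>\<^sub>M Z (w, t))) E \<partial>K t)"
proof -
  note [measurable] =
    K[unfolded transition_prob_space_def markov_kernel_def]
    X[unfolded transitional_rv_def markov_kernel_def]
    Y[unfolded transitional_rv_def markov_kernel_def]
    Z[unfolded transitional_rv_def markov_kernel_def]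
  have N: "(\<lambda>p. X p \<Otimes>\<^sub>M (Y p \<Otimes>\<^sub>M Z p)) \<in> W \<Otimes>\<^sub>M T \<rightarrow>\<^sub>M prob_algebra (MX \<Otimes>\<^sub>M (MY \<Otimes>\<^sub>M MZ))"
    by (intro measurable_pair_prob) measurable
  have N': "(\<lambda>(t, w). X (w, t) \<Otimes>\<^sub>M (Y (w, t) \<Otimes>\<^sub>M Z (w, t)))
      \<in> T \<Otimes>\<^sub>M W \<rightarrow>\<^sub>M prob_algebra (MX \<Otimes>\<^sub>M (MY \<Otimes>\<^sub>M MZ))"
    using measurable_compose[OF measurable_pair_swap' N] by (simp add: case_prod_beta')
  show "markov_kernel T (MX \<Otimes>\<^sub>M (MY \<Otimes>\<^sub>M MZ)) (joint_kernel K X Y Z)"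
    unfolding markov_kernel_def joint_kernel_def
    by (rule measurable_bind_prob_space2[OF _ N']) measurable
  show "emeasure (joint_kernel K X Y Z t) E =
         (\<integral>\<^sup>+w. emeasure (X (w, t) \<Otimes>\<^sub>M (Y (w, t) \<Otimes>\<^sub>M Z (w, t))) E \<partial>K t)"
    if t: "t \<in> space T" and E: "E \<in> sets (MX \<Otimes>\<^sub>M (MY \<Otimes>\<^sub>M MZ))"
  proof -
    have Kt: "K t \<in> space (prob_algebra W)"
      using t by (rule measurable_space[rotated]) measurable
    have "(\<lambda>w. X (w, t) \<Otimes>\<^sub>M (Y (w, t) \<Otimes>\<^sub>M Z (w, t)))
        \<in> W \<rightarrow>\<^sub>M prob_algebra (MX \<Otimes>\<^sub>M (MY \<Otimes>\<^sub>M MZ))"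
      using measurable_compose[OF measurable_Pair2'[OF t] N] by simp
    then show ?thesis
      unfolding joint_kernel_def using Kt E
      by (intro emeasure_bind_prob_algebra)
  qed
qed

definition marginal_kernel_YZ ::
  "'y measure \<Rightarrow> 'z measure \<Rightarrow> ('t \<Rightarrow> 'w measure) \<Rightarrow> ('w \<times> 't \<Rightarrow> 'x measure) \<Rightarrow>
   ('w \<times> 't \<Rightarrow> 'y measure) \<Rightarrow> ('w \<times> 't \<Rightarrow> 'z measure) \<Rightarrow> 't \<Rightarrow> ('y \<times> 'z) measure" where
  "marginal_kernel_YZ MY MZ K X Y Z t = distr (joint_kernel K X Y Z t) (MY \<Otimes>\<^sub>M MZ) snd"

text \<open>
  The kernel \<open>Q\<close> is a single kernel on all of \<open>MZ\<close>, independent of \<open>t\<close>, and the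
  factorisation is required for every \<open>t\<close>.
\<close>

definition trans_cond_indep ::
  "'t measure \<Rightarrow> ('t \<Rightarrow> 'w measure) \<Rightarrow>
   'x measure \<Rightarrow> ('w \<times> 't \<Rightarrow> 'x measure) \<Rightarrow>
   'y measure \<Rightarrow> ('w \<times> 't \<Rightarrow> 'y measure) \<Rightarrow>
   'z measure \<Rightarrow> ('w \<times> 't \<Rightarrow> 'z measure) \<Rightarrow> bool" where
  "trans_cond_indep T K MX X MY Y MZ Z \<longleftrightarrow>
     (\<exists>Q. markov_kernel MZ MX Q \<and>
       (\<forall>t\<in>space T. \<forall>A\<in>sets MX. \<forall>B\<in>sets MY. \<forall>C\<in>sets MZ.
          emeasure (joint_kernel K X Y Z t) (A \<times> B \<times> C) =
          (\<integral>\<^sup>+(y, z). indicator B y * indicator C z * emeasure (Q z) A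
             \<partial>marginal_kernel_YZ MY MZ K X Y Z t)))"

definition standard_space :: "'a measure \<Rightarrow> bool" where
  "standard_space M \<longleftrightarrow>
     (\<exists>S::real set. S \<in> sets borel \<and> S \<subseteq> {0..1} \<and>
       (\<exists>f\<in>M \<rightarrow>\<^sub>M restrict_space borel S. \<exists>g\<in>restrict_space borel S \<rightarrow>\<^sub>M M.
          (\<forall>x\<in>space M. g (f x) = x) \<and> (\<forall>s\<in>S. f (g s) = s)))"

end

theory Submission imports Defs begin

text \<open>
  Since \<open>F\<close> and \<open>H\<close> depend on \<open>t\<close> alone, all randomness sits in \<open>Y\<close>: for fixed \<open>t\<close> the
  joint kernel is the law \<open>N\<^sub>t\<close> of \<open>Y\<close> under \<open>K t\<close>, pushed forward along \<open>y \<mapsto> (F t, y, H t)\<close>.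
  On a box \<open>A \<times> B \<times> C\<close> the factorisation through a kernel \<open>Q\<close> therefore reads
  \<open>1\<^sub>A (F t) N\<^sub>t(B) 1\<^sub>C (H t) = N\<^sub>t(B) 1\<^sub>C (H t) Q (H t) A\<close>. As \<open>N\<^sub>t\<close> has mass one, taking \<open>B\<close> and \<open>C\<close>
  to be the whole spaces shows that conditional independence holds iff \<open>Q (H t)\<close> is the Dirac
  measure at \<open>F t\<close> for every \<open>t\<close> (lemma \<open>trans_cond_indep_deterministic_iff\<close>).

  If \<open>F = \<phi> \<circ> H\<close>, then \<open>Q h = \<delta>\<^bsub>\<phi> h\<^esub>\<close> is such a kernel. Conversely, one has to read the point off
  a Dirac measure measurably, by a map defined on all of \<open>MH\<close>, although \<open>Q h\<close> need not be
  Dirac outside the range of \<open>H\<close>, and that range need not be measurable. Standardness of the target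
  resolves this: its points become real numbers, a Dirac measure on \<open>\<real>\<close> has its point as its mean,
  and the mean is a measurable function of the measure (lemma \<open>measurable_Dirac_point\<close>).
\<close>

section \<open>Reading off the point of a Dirac measure\<close>

text \<open>
  The mean \<open>h \<mapsto> \<integral>f dQ h\<close> of a real coordinate \<open>f\<close> is measurable in \<open>h\<close> and equals \<open>f x\<close> when
  \<open>Q h = \<delta>\<^sub>x\<close>. For other \<open>h\<close> the mean may leave the range \<open>S\<close> of the coordinate; since \<open>S\<close> is Borel,
  a default point can be used there. A default point exists because \<open>Q h\<close>, being a probability
  measure, lives on a nonempty space.
\<close>

lemma measurable_Dirac_point:
  assumes "standard_space MF" and "markov_kernel MH MF Q"
  shows "\<exists>\<phi>\<in>MH \<rightarrow>\<^sub>M MF. \<forall>h\<in>space MH. \<forall>x\<in>space MF. Q h = return MF x \<longrightarrow> \<phi> h = x"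
proof (cases "space MH = {}")
  case True
  then show ?thesis
    by (auto simp: measurable_def intro!: bexI[of _ "\<lambda>_. undefined"])
next
  case False
  have Q: "Q \<in> MH \<rightarrow>\<^sub>M prob_algebra MF"
    using assms(2) by (simp add: markov_kernel_def)
  have [measurable]: "Q \<in> MH \<rightarrow>\<^sub>M subprob_algebra MF"
    using Q by (rule measurable_prob_algebraD)
  from assms(1) obtain S :: "real set" and f g where
    S[measurable]: "S \<in> sets borel" and f: "f \<in> MF \<rightarrow>\<^sub>M restrict_space borel S"
    and g: "g \<in> restrict_space borel S \<rightarrow>\<^sub>M MF" and gf: "\<And>x. x \<in> space MF \<Longrightarrow> g (f x) = x"
    unfolding standard_space_def by blast
  have f_borel[measurable]: "f \<in> borel_measurable MF" and f_S: "\<And>x. x \<in> space MF \<Longrightarrow> f x \<in> S"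
    using f by (auto simp: measurable_restrict_space2_iff)
  obtain h0 where "h0 \<in> space MH"
    using False by auto
  with Q have "Q h0 \<in> space (prob_algebra MF)"
    by (rule measurable_space)
  then have "sets (Q h0) = sets MF" "prob_space (Q h0)"
    by (simp_all add: space_prob_algebra)
  then have "space MF \<noteq> {}"
    using prob_space.not_empty sets_eq_imp_space_eq by metis
  then obtain x0 where x0: "x0 \<in> space MF"
    by auto
  define mean where "mean h = (\<integral>x. f x \<partial>Q h)" for h
  define \<phi> where "\<phi> h = (if mean h \<in> S then g (mean h) else x0)" for h
  have mean[measurable]: "mean \<in> borel_measurable MH"
    unfolding mean_def by measurable
  have "(\<lambda>s. if s \<in> S then g s else x0) \<in> borel \<rightarrow>\<^sub>M MF"
    by (subst measurable_If_restrict_space_iff) (use g x0 in auto)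
  then have "\<phi> \<in> MH \<rightarrow>\<^sub>M MF"
    using measurable_compose[OF mean] by (simp add: \<phi>_def[abs_def])
  moreover have "\<phi> h = x" if "x \<in> space MF" "Q h = return MF x" for h x
  proof -
    have "mean h = f x"
      using that by (simp add: mean_def integral_return)
    then show ?thesis
      using that f_S gf by (simp add: \<phi>_def)
  qed
  ultimately show ?thesis
    by blast
qed

section \<open>Joint kernels with two deterministic components\<close>

lemma pair_return_left:
  assumes "x \<in> space MX" "prob_space N"
  shows "return MX x \<Otimes>\<^sub>M N = distr N (MX \<Otimes>\<^sub>M N) (Pair x)"
proof -
  interpret N: prob_space N by fact
  interpret R: prob_space "return MX x" using assms(1) by (rule prob_space_return)
  show ?thesis
  proof (rule pair_measure_eqI)
    fix A B assume "A \<in> sets (return MX x)" "B \<in> sets N"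
    moreover have "Pair x -` (A \<times> B) \<inter> space N = (if x \<in> A then B else {})"
      using sets.sets_into_space[OF \<open>B \<in> sets N\<close>] by auto
    ultimately show "emeasure (return MX x) A * emeasure N B =
        emeasure (distr N (MX \<Otimes>\<^sub>M N) (Pair x)) (A \<times> B)"
      using assms(1) by (simp add: emeasure_distr indicator_def)
  qed (auto intro: N.sigma_finite_measure_axioms R.sigma_finite_measure_axioms)
qed

lemma pair_return_right:
  assumes "prob_space N" "z \<in> space MZ"
  shows "N \<Otimes>\<^sub>M return MZ z = distr N (N \<Otimes>\<^sub>M MZ) (\<lambda>y. (y, z))"
proof -
  interpret N: prob_space N by fact
  interpret R: prob_space "return MZ z" using assms(2) by (rule prob_space_return)
  show ?thesis
  proof (rule pair_measure_eqI)
    fix B C assume "B \<in> sets N" "C \<in> sets (return MZ z)"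
    moreover have "(\<lambda>y. (y, z)) -` (B \<times> C) \<inter> space N = (if z \<in> C then B else {})"
      using sets.sets_into_space[OF \<open>B \<in> sets N\<close>] by auto
    ultimately show "emeasure N B * emeasure (return MZ z) C =
        emeasure (distr N (N \<Otimes>\<^sub>M MZ) (\<lambda>y. (y, z))) (B \<times> C)"
      using assms(2) by (simp add: emeasure_distr indicator_def)
  qed (auto intro: N.sigma_finite_measure_axioms R.sigma_finite_measure_axioms)
qed

lemma return_pair_return:
  assumes N: "N \<in> space (prob_algebra MY)" and x: "x \<in> space MX" and z: "z \<in> space MZ"
  shows "return MX x \<Otimes>\<^sub>M (N \<Otimes>\<^sub>M return MZ z) =
    distr N (MX \<Otimes>\<^sub>M (MY \<Otimes>\<^sub>M MZ)) (\<lambda>y. (x, y, z))"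
proof -
  have sets_N[measurable_cong]: "sets N = sets MY" and prob: "prob_space N"
    using N by (auto simp: space_prob_algebra)
  let ?NZ = "distr N (N \<Otimes>\<^sub>M MZ) (\<lambda>y. (y, z))"
  have [measurable]: "(\<lambda>y. (y, z)) \<in> N \<rightarrow>\<^sub>M N \<Otimes>\<^sub>M MZ" "Pair x \<in> N \<Otimes>\<^sub>M MZ \<rightarrow>\<^sub>M MX \<Otimes>\<^sub>M (N \<Otimes>\<^sub>M MZ)"
    using x z by simp_all
  have "return MX x \<Otimes>\<^sub>M (N \<Otimes>\<^sub>M return MZ z) = return MX x \<Otimes>\<^sub>M ?NZ"
    by (simp only: pair_return_right[OF prob z])
  also have "\<dots> = distr ?NZ (MX \<Otimes>\<^sub>M ?NZ) (Pair x)"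
    by (intro pair_return_left x prob_space.prob_space_distr[OF prob]) measurable
  also have "\<dots> = distr ?NZ (MX \<Otimes>\<^sub>M (N \<Otimes>\<^sub>M MZ)) (Pair x)"
    by (intro distr_cong refl sets_pair_measure_cong) simp
  also have "\<dots> = distr N (MX \<Otimes>\<^sub>M (N \<Otimes>\<^sub>M MZ)) (\<lambda>y. (x, y, z))"
    by (subst distr_distr) (auto simp: comp_def)
  also have "\<dots> = distr N (MX \<Otimes>\<^sub>M (MY \<Otimes>\<^sub>M MZ)) (\<lambda>y. (x, y, z))"
    by (intro distr_cong refl sets_pair_measure_cong sets_N)
  finally show ?thesis .
qed

lemma transitional_rv_section:
  assumes "transitional_rv W T MY Y" "t \<in> space T"
  shows "(\<lambda>w. Y (w, t)) \<in> W \<rightarrow>\<^sub>M prob_algebra MY"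
  using assms measurable_Pair2'[of t T W]
  by (auto simp: transitional_rv_def markov_kernel_def intro: measurable_compose)

lemma law_in_prob_algebra:
  assumes "transition_prob_space W T K" "transitional_rv W T MY Y" "t \<in> space T"
  shows "K t \<bind> (\<lambda>w. Y (w, t)) \<in> space (prob_algebra MY)"
proof -
  have "K t \<in> space (prob_algebra W)"
    using assms(1,3) by (auto simp: transition_prob_space_def markov_kernel_def dest: measurable_space)
  then show ?thesis
    using transitional_rv_section[OF assms(2,3)]
    by (auto simp: space_prob_algebra sets_bind' intro: prob_space_bind')
qed

text \<open>
  Pushforward commutes with mixing, so the deterministic components can be pulled out of the
  mixture over \<open>w\<close>.
\<close>

lemma joint_kernel_deterministic:
  assumes K: "transition_prob_space W T K" and Y: "transitional_rv W T MY Y" and t: "t \<in> space T"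
    and F: "F t \<in> space MF" and H: "H t \<in> space MH"
  shows "joint_kernel K (dirac_kernel MF (\<lambda>(w, t). F t)) Y (dirac_kernel MH (\<lambda>(w, t). H t)) t =
    distr (K t \<bind> (\<lambda>w. Y (w, t))) (MF \<Otimes>\<^sub>M (MY \<Otimes>\<^sub>M MH)) (\<lambda>y. (F t, y, H t))"
proof -
  have Kt: "sets (K t) = sets W" "prob_space (K t)"
    using K t by (auto simp: transition_prob_space_def markov_kernel_iff)
  have Yt: "(\<lambda>w. Y (w, t)) \<in> K t \<rightarrow>\<^sub>M prob_algebra MY"
    using transitional_rv_section[OF Y t] by (simp cong: measurable_cong_sets add: Kt)
  have "joint_kernel K (dirac_kernel MF (\<lambda>(w, t). F t)) Y (dirac_kernel MH (\<lambda>(w, t). H t)) t =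
      K t \<bind> (\<lambda>w. distr (Y (w, t)) (MF \<Otimes>\<^sub>M (MY \<Otimes>\<^sub>M MH)) (\<lambda>y. (F t, y, H t)))"
    unfolding joint_kernel_def dirac_kernel_def
    by (intro bind_cong refl) (simp add: return_pair_return[OF measurable_space[OF Yt] F H])
  also have "\<dots> = distr (K t \<bind> (\<lambda>w. Y (w, t))) (MF \<Otimes>\<^sub>M (MY \<Otimes>\<^sub>M MH)) (\<lambda>y. (F t, y, H t))"
    by (rule distr_bind[symmetric, OF measurable_prob_algebraD[OF Yt]])
      (use F H prob_space.not_empty[OF Kt(2)] in auto)
  finally show ?thesis .
qed

section \<open>Conditional independence of deterministic variables\<close>

text \<open>
  On every box, the two sides of the factorisation are the common factor \<open>N t B \<cdot> 1\<^sub>C (H t)\<close> times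
  \<open>\<delta>\<^bsub>F t\<^esub>(A)\<close> and \<open>Q (H t) A\<close> respectively. The factor is one when \<open>B\<close> and \<open>C\<close> are the whole spaces,
  so it can be cancelled.
\<close>

lemma trans_cond_indep_deterministic_iff:
  assumes K: "transition_prob_space W T K" and Y: "transitional_rv W T MY Y"
    and F: "F \<in> T \<rightarrow>\<^sub>M MF" and H: "H \<in> T \<rightarrow>\<^sub>M MH"
  shows "trans_cond_indep T K MF (dirac_kernel MF (\<lambda>(w, t). F t)) MY Y
      MH (dirac_kernel MH (\<lambda>(w, t). H t)) \<longleftrightarrow>
    (\<exists>Q. markov_kernel MH MF Q \<and> (\<forall>t\<in>space T. Q (H t) = return MF (F t)))"
proof -
  let ?X = "dirac_kernel MF (\<lambda>(w, t). F t) :: 'a \<times> 'b \<Rightarrow> _"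
  let ?Z = "dirac_kernel MH (\<lambda>(w, t). H t) :: 'a \<times> 'b \<Rightarrow> _"
  define N where "N t = K t \<bind> (\<lambda>w. Y (w, t))" for t
  have sets_N: "sets (N t) = sets MY" and prob_N: "prob_space (N t)" if "t \<in> space T" for t
    using law_in_prob_algebra[OF K Y that] by (auto simp: N_def space_prob_algebra)
  have Ft: "F t \<in> space MF" and Ht: "H t \<in> space MH" if "t \<in> space T" for t
    using that F H by (auto dest: measurable_space)
  have joint: "joint_kernel K ?X Y ?Z t = distr (N t) (MF \<Otimes>\<^sub>M (MY \<Otimes>\<^sub>M MH)) (\<lambda>y. (F t, y, H t))"
    if "t \<in> space T" for t
    unfolding N_def by (intro joint_kernel_deterministic[OF K Y] Ft Ht that)
  have meas_insert: "(\<lambda>y. (F t, y, H t)) \<in> N t \<rightarrow>\<^sub>M MF \<Otimes>\<^sub>M (MY \<Otimes>\<^sub>M MH)" if "t \<in> space T" for t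
    using Ft[OF that] Ht[OF that] by (simp cong: measurable_cong_sets add: sets_N[OF that])

  have lhs: "emeasure (joint_kernel K ?X Y ?Z t) (A \<times> B \<times> C) =
      indicator A (F t) * (emeasure (N t) B * indicator C (H t))"
    if t: "t \<in> space T" and A: "A \<in> sets MF" and B: "B \<in> sets MY" and C: "C \<in> sets MH" for t A B C
  proof -
    have "(\<lambda>y. (F t, y, H t)) -` (A \<times> B \<times> C) \<inter> space (N t) =
        (if F t \<in> A \<and> H t \<in> C then B else {})"
      using sets.sets_into_space[OF B] sets_eq_imp_space_eq[OF sets_N[OF t]] by auto
    then show ?thesis
      using A B C by (simp add: joint[OF t] emeasure_distr[OF meas_insert[OF t]] indicator_def)
  qed

  have rhs: "(\<integral>\<^sup>+(y, z). indicator B y * indicator C z * emeasure (Q z) A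
        \<partial>marginal_kernel_YZ MY MH K ?X Y ?Z t) =
      emeasure (Q (H t)) A * (emeasure (N t) B * indicator C (H t))"
    if Q: "markov_kernel MH MF Q" and t: "t \<in> space T"
      and A: "A \<in> sets MF" and B[measurable]: "B \<in> sets MY" and C[measurable]: "C \<in> sets MH"
    for Q t A B C
  proof -
    have [measurable]: "(\<lambda>z. emeasure (Q z) A) \<in> borel_measurable MH"
      using Q A by (simp add: markov_kernel_iff)
    have B': "B \<in> sets (N t)"
      using B by (simp add: sets_N[OF t])
    have pair: "(\<lambda>y. (y, H t)) \<in> N t \<rightarrow>\<^sub>M MY \<Otimes>\<^sub>M MH"
      using Ht[OF t] by (simp cong: measurable_cong_sets add: sets_N[OF t])
    have "marginal_kernel_YZ MY MH K ?X Y ?Z t = distr (N t) (MY \<Otimes>\<^sub>M MH) (\<lambda>y. (y, H t))"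
      unfolding marginal_kernel_YZ_def joint[OF t]
      by (subst distr_distr[OF _ meas_insert[OF t]]) (auto simp: comp_def)
    then have "(\<integral>\<^sup>+(y, z). indicator B y * indicator C z * emeasure (Q z) A
        \<partial>marginal_kernel_YZ MY MH K ?X Y ?Z t) =
      (\<integral>\<^sup>+y. indicator B y * indicator C (H t) * emeasure (Q (H t)) A \<partial>N t)"
      by (simp add: nn_integral_distr[OF pair])
    also have "\<dots> = (\<integral>\<^sup>+y. (indicator C (H t) * emeasure (Q (H t)) A) * indicator B y \<partial>N t)"
      by (intro nn_integral_cong) (simp add: ac_simps)
    also have "\<dots> = (indicator C (H t) * emeasure (Q (H t)) A) * emeasure (N t) B"
      by (rule nn_integral_cmult_indicator[OF B'])
    also have "\<dots> = emeasure (Q (H t)) A * (emeasure (N t) B * indicator C (H t))"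
      by (simp add: ac_simps)
    finally show ?thesis .
  qed

  have "(\<forall>A\<in>sets MF. \<forall>B\<in>sets MY. \<forall>C\<in>sets MH.
         emeasure (joint_kernel K ?X Y ?Z t) (A \<times> B \<times> C) =
         (\<integral>\<^sup>+(y, z). indicator B y * indicator C z * emeasure (Q z) A
            \<partial>marginal_kernel_YZ MY MH K ?X Y ?Z t)) \<longleftrightarrow> Q (H t) = return MF (F t)" (is "?L \<longleftrightarrow> _")
    if Q: "markov_kernel MH MF Q" and t: "t \<in> space T" for Q t
  proof
    assume L: ?L
    have N1: "emeasure (N t) (space MY) = 1"
      using prob_space.emeasure_space_1[OF prob_N[OF t]] sets_eq_imp_space_eq[OF sets_N[OF t]] by simp
    show "Q (H t) = return MF (F t)"
    proof (rule measure_eqI)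
      show sets_Q: "sets (Q (H t)) = sets (return MF (F t))"
        using Q Ht[OF t] by (simp add: markov_kernel_iff)
      fix A assume "A \<in> sets (Q (H t))"
      then have A: "A \<in> sets MF"
        using sets_Q by simp
      from L[rule_format, OF A sets.top sets.top]
      show "emeasure (Q (H t)) A = emeasure (return MF (F t)) A"
        using A by (simp add: lhs[OF t A sets.top sets.top] rhs[OF Q t A sets.top sets.top] N1 Ht[OF t])
    qed
  next
    assume "Q (H t) = return MF (F t)"
    then show ?L
      using lhs[OF t] rhs[OF Q t] by simp
  qed
  then show ?thesis
    unfolding trans_cond_indep_def by (intro ex_cong1 conj_cong refl ball_cong) blast
qed

theorem theorem3p11:
  fixes W :: "'w measure" and T :: "'t measure" and K :: "'t \<Rightarrow> 'w measure"
    and MF :: "'f measure" and F :: "'t \<Rightarrow> 'f"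
    and MH :: "'h measure" and H :: "'t \<Rightarrow> 'h"
    and MY :: "'y measure" and Y :: "'w \<times> 't \<Rightarrow> 'y measure"
  assumes "transition_prob_space W T K"
    and "F \<in> T \<rightarrow>\<^sub>M MF" and "standard_space MF"
    and "H \<in> T \<rightarrow>\<^sub>M MH"
    and "transitional_rv W T MY Y"
  shows "trans_cond_indep T K
           MF (dirac_kernel MF (\<lambda>(w, t). F t))
           MY Y
           MH (dirac_kernel MH (\<lambda>(w, t). H t))
     \<longleftrightarrow> (\<exists>\<phi>. \<phi> \<in> MH \<rightarrow>\<^sub>M MF \<and> (\<forall>t\<in>space T. F t = \<phi> (H t)))"
  unfolding trans_cond_indep_deterministic_iff[OF assms(1,5,2,4)]
proof
  assume "\<exists>Q. markov_kernel MH MF Q \<and> (\<forall>t\<in>space T. Q (H t) = return MF (F t))"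
  then obtain Q where "markov_kernel MH MF Q" and Q: "\<forall>t\<in>space T. Q (H t) = return MF (F t)"
    by blast
  with measurable_Dirac_point[OF assms(3)] obtain \<phi> where "\<phi> \<in> MH \<rightarrow>\<^sub>M MF"
    and "\<forall>h\<in>space MH. \<forall>x\<in>space MF. Q h = return MF x \<longrightarrow> \<phi> h = x"
    by blast
  then show "\<exists>\<phi>. \<phi> \<in> MH \<rightarrow>\<^sub>M MF \<and> (\<forall>t\<in>space T. F t = \<phi> (H t))"
    using Q measurable_space[OF assms(2)] measurable_space[OF assms(4)] by metis
next
  assume "\<exists>\<phi>. \<phi> \<in> MH \<rightarrow>\<^sub>M MF \<and> (\<forall>t\<in>space T. F t = \<phi> (H t))"
  then obtain \<phi> where \<phi>: "\<phi> \<in> MH \<rightarrow>\<^sub>M MF" "\<forall>t\<in>space T. F t = \<phi> (H t)"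
    by blast
  have "markov_kernel MH MF (\<lambda>h. return MF (\<phi> h))"
    unfolding markov_kernel_def using measurable_compose[OF \<phi>(1) measurable_return_prob_space] .
  with \<phi>(2) show "\<exists>Q. markov_kernel MH MF Q \<and> (\<forall>t\<in>space T. Q (H t) = return MF (F t))"
    by auto
qed

end
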